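(* Let $C=(C_n)_{n\ge 0}$ be the sequence of Catalan numbers, and let $\alpha,\beta$ be (complex) numbers with $\alpha^2-4\beta\neq 0$; let $\sqrt{\alpha^2-4\beta}$ denote a fixed square root. Then for every integer $n\ge 0$, $$\det[\alpha^2C_{i+j}-\beta C_{i+j+1}]_{0\le i,j\le n}=\frac{1}{2^{2n+3}\sqrt{\alpha^2-4\beta}}\left[\left(\alpha+\sqrt{\alpha^2-4\beta}\right)^{2n+3}-\left(\alpha-\sqrt{\alpha^2-4\beta}\right)^{2n+3}\right],$$ and, if moreover $\alpha\ne 0$, $$\det[\alpha^2C_{i+j+1}-\beta C_{i+j+2}]_{0\le i,j\le n}=\frac{1}{2^{2n+4}\,\alpha\sqrt{\alpha^2-4\beta}}\left[\left(\alpha+\sqrt{\alpha^2-4\beta}\right)^{2n+4}-\left(\alpha-\sqrt{\alpha^2-4\beta}\right)^{2n+4}\right].$$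
   Context: $C_n=\frac{1}{n+1}\binom{2n}{n}$ is the $n$-th Catalan number. *)

theory Defs
  imports Complex_Main "Jordan_Normal_Form.Determinant"
begin

definition catalan :: "nat \<Rightarrow> complex" where
  "catalan n = 1 / of_nat (n + 1) * of_nat ((2 * n) choose n)"

end

theory Submission
  imports Defs
begin

text \<open>
  Let \<open>A\<close> be the lower unitriangular array generated by the infinite tridiagonal matrix \<open>J\<close> with
  off-diagonal entries \<open>1\<close> and diagonal \<open>(b, 2, 2, \<dots>)\<close>, that is, row \<open>i\<close> of \<open>A\<close> is row \<open>0\<close> of
  \<open>J ^ i\<close>. As \<open>J\<close> is symmetric, \<open>A A\<^sup>T\<close> and \<open>A J A\<^sup>T\<close> are the Hankel matrices of the first column
  \<open>m\<close> of \<open>A\<close> and of its shift; \<open>m i\<close> is \<open>C\<^sub>i\<close> for \<open>b = 1\<close> and \<open>C\<^sub>i\<^sub>+\<^sub>1\<close> for \<open>b = 2\<close>. All of this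
  survives truncation, so both determinants reduce to those of the truncations of \<open>\<alpha>\<^sup>2 - \<beta> J\<close>.
  Writing \<open>\<alpha> = x + y\<close> and \<open>\<beta> = x y\<close>, where \<open>x - y\<close> is the chosen square root, the three-term
  recurrence of these continuants has the coefficients \<open>x\<^sup>2 + y\<^sup>2\<close> and \<open>x\<^sup>2 y\<^sup>2\<close>.
\<close>

section \<open>Tridiagonal determinants\<close>

text \<open>Laplace expansion along the last row leaves two terms. The minor of the off-diagonal one
  has a last column with a single nonzero entry, so expanding it there gives the leading block of
  size \<open>n\<close>.\<close>

lemma det_tridiagonal:
  fixes f :: "nat \<times> nat \<Rightarrow> 'a :: comm_ring_1"
  assumes f: "\<And>i j. i + 1 < j \<or> j + 1 < i \<Longrightarrow> f (i, j) = 0"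
  shows "det (mat (n + 2) (n + 2) f) =
    f (n + 1, n + 1) * det (mat (n + 1) (n + 1) f) - f (n + 1, n) * f (n, n + 1) * det (mat n n f)"
proof -
  let ?T = "\<lambda>n. mat n n f"
  let ?M = "?T (n + 2)"
  let ?D = "mat_delete ?M (n + 1) n"
  have D: "?D \<in> carrier_mat (n + 1) (n + 1)"
    using mat_delete_carrier[of ?M "n + 2" "n + 2"] by simp
  have DD: "mat_delete ?D n n = ?T n"
    by (rule eq_matI) (auto simp: mat_delete_def)
  have "det ?D = (\<Sum>i<n + 1. ?D $$ (i, n) * cofactor ?D i n)"
    using laplace_expansion_column[OF D, of n] by simp
  also have "\<dots> = ?D $$ (n, n) * cofactor ?D n n"
  proof -
    have "(\<Sum>i<n. ?D $$ (i, n) * cofactor ?D i n) = 0"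
      by (rule sum.neutral) (auto simp: mat_delete_def f)
    then show ?thesis by simp
  qed
  also have "\<dots> = f (n, n + 1) * det (?T n)"
  proof -
    have "?D $$ (n, n) = f (n, n + 1)" by (simp add: mat_delete_def)
    then show ?thesis unfolding cofactor_def DD by simp
  qed
  finally have detD: "det ?D = f (n, n + 1) * det (?T n)" .
  have DM: "mat_delete ?M (n + 1) (n + 1) = ?T (n + 1)"
    by (rule eq_matI) (auto simp: mat_delete_def)
  have "det ?M = (\<Sum>j<n + 2. ?M $$ (n + 1, j) * cofactor ?M (n + 1) j)"
    by (rule laplace_expansion_row) auto
  also have "\<dots> = (\<Sum>j<n. ?M $$ (n + 1, j) * cofactor ?M (n + 1) j)
      + ?M $$ (n + 1, n) * cofactor ?M (n + 1) n + ?M $$ (n + 1, n + 1) * cofactor ?M (n + 1) (n + 1)"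
    by simp
  also have "(\<Sum>j<n. ?M $$ (n + 1, j) * cofactor ?M (n + 1) j) = 0"
    by (rule sum.neutral) (auto simp: f)
  also have "cofactor ?M (n + 1) n = - det ?D"
    by (simp add: cofactor_def)
  also have "cofactor ?M (n + 1) (n + 1) = det (?T (n + 1))"
    unfolding cofactor_def DM by simp
  finally show ?thesis
    unfolding detD by (simp add: algebra_simps)
qed

definition tridiag :: "'a \<Rightarrow> 'a \<Rightarrow> 'a :: zero \<Rightarrow> nat \<times> nat \<Rightarrow> 'a" where
  "tridiag d\<^sub>0 d e = (\<lambda>(i, j). if i = j then (if i = 0 then d\<^sub>0 else d)
     else if i = j + 1 \<or> j = i + 1 then e else 0)"

lemma det_tridiag_1: "det (mat 1 1 (tridiag d\<^sub>0 d e)) = (d\<^sub>0 :: 'a :: comm_ring_1)"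
  by (subst det_single) (auto simp: tridiag_def)

lemma det_tridiag_Suc_Suc:
  fixes d\<^sub>0 d e :: "'a :: comm_ring_1"
  shows "det (mat (Suc (Suc n)) (Suc (Suc n)) (tridiag d\<^sub>0 d e)) =
    d * det (mat (Suc n) (Suc n) (tridiag d\<^sub>0 d e)) - e\<^sup>2 * det (mat n n (tridiag d\<^sub>0 d e))"
proof -
  have "tridiag d\<^sub>0 d e (i, j) = 0" if "i + 1 < j \<or> j + 1 < i" for i j
    using that by (auto simp: tridiag_def)
  note det_tridiagonal[of "tridiag d\<^sub>0 d e" n, OF this]
  moreover have "tridiag d\<^sub>0 d e (n + 1, n + 1) = d" "tridiag d\<^sub>0 d e (n + 1, n) = e"
    "tridiag d\<^sub>0 d e (n, n + 1) = e"
    by (auto simp: tridiag_def)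
  ultimately show ?thesis
    by (simp add: power2_eq_square)
qed

text \<open>The powers of x^2 and of y^2 both satisfy the continuant recurrence, whose
  characteristic polynomial is (t - x^2)(t - y^2). The corner entry is (x^3 - y^3)/(x - y), which
  fits the case of size 1.\<close>

lemma det_tridiag_odd_powers:
  fixes x y :: "'a :: comm_ring_1"
  shows "(x - y) * det (mat n n (tridiag (x\<^sup>2 + y\<^sup>2 + x * y) (x\<^sup>2 + y\<^sup>2) (- (x * y))))
    = x ^ (2 * n + 1) - y ^ (2 * n + 1)"
proof (induction n rule: induct_nat_012)
  case 1
  show ?case
    unfolding One_nat_def[symmetric] det_tridiag_1 by (simp add: algebra_simps power_numeral_reduce)
next
  case (ge2 n)
  let ?D = "\<lambda>n. det (mat n n (tridiag (x\<^sup>2 + y\<^sup>2 + x * y) (x\<^sup>2 + y\<^sup>2) (- (x * y))))"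
  have "(x - y) * ?D (Suc (Suc n)) =
      (x\<^sup>2 + y\<^sup>2) * ((x - y) * ?D (Suc n)) - (x * y)\<^sup>2 * ((x - y) * ?D n)"
    unfolding det_tridiag_Suc_Suc by (simp add: algebra_simps)
  then show ?case
    unfolding ge2 by (simp add: algebra_simps power2_eq_square)
qed (simp add: algebra_simps)

lemma det_tridiag_even_powers:
  fixes x y :: "'a :: comm_ring_1"
  shows "(x\<^sup>2 - y\<^sup>2) * det (mat n n (tridiag (x\<^sup>2 + y\<^sup>2) (x\<^sup>2 + y\<^sup>2) (- (x * y))))
    = x ^ (2 * n + 2) - y ^ (2 * n + 2)"
proof (induction n rule: induct_nat_012)
  case 1
  show ?case
    unfolding One_nat_def[symmetric] det_tridiag_1 by (simp add: algebra_simps power_numeral_reduce)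
next
  case (ge2 n)
  let ?D = "\<lambda>n. det (mat n n (tridiag (x\<^sup>2 + y\<^sup>2) (x\<^sup>2 + y\<^sup>2) (- (x * y))))"
  have "(x\<^sup>2 - y\<^sup>2) * ?D (Suc (Suc n)) =
      (x\<^sup>2 + y\<^sup>2) * ((x\<^sup>2 - y\<^sup>2) * ?D (Suc n)) - (x * y)\<^sup>2 * ((x\<^sup>2 - y\<^sup>2) * ?D n)"
    unfolding det_tridiag_Suc_Suc by (simp add: algebra_simps)
  then show ?case
    unfolding ge2 by (simp add: algebra_simps power2_eq_square)
qed (simp add: power2_eq_square)

section \<open>Catalan triangles and Hankel matrices\<close>

fun cat_tri :: "'a :: comm_ring_1 \<Rightarrow> nat \<Rightarrow> nat \<Rightarrow> 'a" where
  "cat_tri b 0 k = (if k = 0 then 1 else 0)"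
| "cat_tri b (Suc i) 0 = b * cat_tri b i 0 + cat_tri b i 1"
| "cat_tri b (Suc i) (Suc k) = cat_tri b i k + 2 * cat_tri b i (Suc k) + cat_tri b i (Suc (Suc k))"

lemma cat_tri_upper: "i < k \<Longrightarrow> cat_tri b i k = 0"
  by (induction b i k rule: cat_tri.induct) auto

lemma cat_tri_diag: "cat_tri b i i = 1"
  by (induction i) (auto simp: cat_tri_upper)

text \<open>The defect in the symmetry of a truncation of \<open>J\<close> is a boundary term, as in the
  Christoffel--Darboux formula.\<close>

lemma cat_tri_shift:
  "(\<Sum>k<Suc N. cat_tri b (Suc i) k * cat_tri b j k) + cat_tri b i N * cat_tri b j (Suc N)
   = (\<Sum>k<Suc N. cat_tri b i k * cat_tri b (Suc j) k) + cat_tri b i (Suc N) * cat_tri b j N"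
  by (induction N) (auto simp: algebra_simps)

text \<open>Steps are moved from \<open>i\<close> to \<open>j\<close> until row \<open>i\<close>
  becomes the unit row 0. Leaving \<open>j\<close> unbounded admits row \<open>N\<close>, which the
  truncation cuts off.\<close>

lemma cat_tri_orthogonality:
  "i < N \<Longrightarrow> (\<Sum>k<N. cat_tri b i k * cat_tri b j k) = cat_tri b (i + j) 0"
proof (induction i arbitrary: j)
  case 0
  then have "(\<Sum>k<N. cat_tri b 0 k * cat_tri b j k) = (\<Sum>k<N. if k = 0 then cat_tri b j k else 0)"
    by (intro sum.cong) auto
  with 0 show ?case by simp
next
  case (Suc i)
  then obtain N' where N': "N = Suc N'" by (cases N) auto
  \<comment> \<open>Both boundary terms of \<open>cat_tri_shift\<close> contain an entry of row
    \<open>i\<close> in column N' or later, hence vanish.\<close>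
  with Suc.prems have "i < N'" by simp
  then have "(\<Sum>k<N. cat_tri b (Suc i) k * cat_tri b j k) = (\<Sum>k<N. cat_tri b i k * cat_tri b (Suc j) k)"
    using cat_tri_shift[where N = N' and b = b and i = i and j = j] by (simp add: N' cat_tri_upper)
  with Suc show ?case by simp
qed

lemma sum_tridiag_cat_tri:
  assumes "k < N" "j < N"
  shows "(\<Sum>l<N. tridiag (p - q * b) (p - q * 2) (- q) (k, l) * cat_tri b j l)
    = p * cat_tri b j k - q * cat_tri b (Suc j) k"
proof -
  let ?g = "\<lambda>l. tridiag (p - q * b) (p - q * 2) (- q) (k, l) * cat_tri b j l"
  \<comment> \<open>The added term is zero since j < N, and now the neighbour \<open>Suc k\<close>
    is in range even for k = N - 1.\<close>
  have "sum ?g {..<N} = sum ?g {..<Suc N}"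
    using assms by (simp add: cat_tri_upper)
  also have "\<dots> = sum ?g ((if k = 0 then {} else {k - 1}) \<union> {k, Suc k})"
    using assms by (intro sum.mono_neutral_right) (auto simp: tridiag_def)
  also have "\<dots> = p * cat_tri b j k - q * cat_tri b (Suc j) k"
    by (cases k) (auto simp: tridiag_def algebra_simps)
  finally show ?thesis .
qed

text \<open>The Hankel matrix factors as A T A^T with A unitriangular, so only det T
  remains.\<close>

lemma det_hankel_cat_tri:
  fixes b p q :: "'a :: comm_ring_1"
  shows "det (mat N N (\<lambda>(i, j). p * cat_tri b (i + j) 0 - q * cat_tri b (i + j + 1) 0))
    = det (mat N N (tridiag (p - q * b) (p - q * 2) (- q)))"
proof -
  let ?H = "mat N N (\<lambda>(i, j). p * cat_tri b (i + j) 0 - q * cat_tri b (i + j + 1) 0)"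
  let ?A = "mat N N (\<lambda>(i, j). cat_tri b i j)"
  let ?T = "mat N N (tridiag (p - q * b) (p - q * 2) (- q))"
  have A: "?A \<in> carrier_mat N N" and T: "?T \<in> carrier_mat N N" by auto
  have detA: "det ?A = 1"
  proof -
    have "det ?A = prod_list (diag_mat ?A)"
      by (rule det_lower_triangular[OF _ A]) (auto simp: cat_tri_upper)
    also have "\<dots> = 1"
      by (simp add: prod_list_diag_prod cat_tri_diag)
    finally show ?thesis .
  qed
  have TA: "?T * transpose_mat ?A = mat N N (\<lambda>(k, j). p * cat_tri b j k - q * cat_tri b (Suc j) k)"
    by (rule eq_matI) (auto simp: scalar_prod_def sum_tridiag_cat_tri lessThan_atLeast0[symmetric])
  have "?H = ?A * (?T * transpose_mat ?A)"
  proof (rule eq_matI, goal_cases)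
    case (1 i j)
    then have ij: "i < N" "j < N" unfolding TA by auto
    then have "(?A * (?T * transpose_mat ?A)) $$ (i, j)
        = (\<Sum>k<N. cat_tri b i k * (p * cat_tri b j k - q * cat_tri b (Suc j) k))"
      unfolding TA by (simp add: scalar_prod_def lessThan_atLeast0)
    also have "\<dots> = p * (\<Sum>k<N. cat_tri b i k * cat_tri b j k)
        - q * (\<Sum>k<N. cat_tri b i k * cat_tri b (Suc j) k)"
      by (simp add: sum_distrib_left sum_subtractf algebra_simps)
    also have "\<dots> = ?H $$ (i, j)"
      using ij by (simp add: cat_tri_orthogonality)
    finally show ?case by simp
  qed auto
  then have "det ?H = det (?A * (?T * transpose_mat ?A))"
    by (rule arg_cong)
  also have "\<dots> = det ?A * det (?T * transpose_mat ?A)"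
    by (rule det_mult[OF A]) (simp add: TA)
  also have "det (?T * transpose_mat ?A) = det ?T * det (transpose_mat ?A)"
    by (rule det_mult[OF T]) simp
  finally show ?thesis
    unfolding det_transpose[OF A] detA by simp
qed

text \<open>Pascal's rule applied twice yields the weights 1, 2, 1 of the recurrence of
  \<open>cat_tri\<close>.\<close>

lemma choose_Suc_Suc_shift:
  "(Suc (Suc m) choose Suc (Suc k)) = (m choose k) + 2 * (m choose Suc k) + (m choose Suc (Suc k))"
  by simp

lemma choose_odd_middle: "(Suc (2 * i) choose Suc i) = (Suc (2 * i) choose i)"
  by (subst binomial_symmetric) auto

text \<open>These are ballot numbers. Only column 0 needs more than Pascal's rule: there the two
  equal middle entries of an odd row of Pascal's triangle enter.\<close>

lemma cat_tri_1:
  "cat_tri 1 i k = of_nat (2 * i choose (i + k)) - of_nat (2 * i choose Suc (i + k))"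
proof (induction "1 :: 'a" i k rule: cat_tri.induct)
  case (2 i)
  have "of_nat (2 * i choose i) + of_nat (2 * i choose Suc i) = (of_nat (Suc (2 * i) choose i) :: 'a)"
    by (simp only: of_nat_add[symmetric] binomial_Suc_Suc[symmetric] choose_odd_middle)
  with 2 show ?case
    by (simp add: algebra_simps)
next
  case (3 i k)
  have "2 * Suc i = Suc (Suc (2 * i))" "Suc i + Suc k = Suc (Suc (i + k))" by auto
  then show ?case
    unfolding cat_tri.simps 3 choose_Suc_Suc_shift by (simp add: algebra_simps)
qed (auto simp: binomial_eq_0)

lemma cat_tri_2:
  "cat_tri 2 i k = of_nat (Suc (2 * i) choose Suc (i + k)) - of_nat (Suc (2 * i) choose Suc (Suc (i + k)))"
proof (induction "2 :: 'a" i k rule: cat_tri.induct)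
  case (2 i)
  have "(of_nat (Suc (2 * i) choose Suc i) :: 'a) = of_nat (Suc (2 * i) choose i)"
    by (simp only: choose_odd_middle)
  moreover have eq: "Suc (2 * Suc i) = Suc (Suc (Suc (2 * i)))" by simp
  ultimately show ?case
    unfolding cat_tri.simps 2 add_0_right eq choose_Suc_Suc_shift
    by (simp add: algebra_simps del: binomial_Suc_Suc)
next
  case (3 i k)
  have "Suc (2 * Suc i) = Suc (Suc (Suc (2 * i)))" "Suc (Suc i + Suc k) = Suc (Suc (Suc (i + k)))" by auto
  then show ?case
    unfolding cat_tri.simps 3 choose_Suc_Suc_shift by (simp add: algebra_simps)
qed (auto simp: binomial_eq_0)

lemma catalan_eq_diff: "catalan n = of_nat (2 * n choose n) - of_nat (2 * n choose Suc n)"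
proof -
  have "Suc n * (2 * n choose Suc n) = (2 * n - n) * (2 * n choose n)"
    by (simp only: binomial_absorb_comp binomial_absorption)
  also have "2 * n - n = n" by simp
  finally have "Suc n * (2 * n choose Suc n) = n * (2 * n choose n)" .
  then have "(of_nat (Suc n) :: complex) * of_nat (2 * n choose Suc n) = of_nat n * of_nat (2 * n choose n)"
    by (simp only: of_nat_mult[symmetric])
  moreover have "(of_nat (Suc n) :: complex) \<noteq> 0"
    by (rule of_nat_neq_0)
  ultimately show ?thesis
    by (simp add: catalan_def field_simps)
qed

lemma cat_tri_1_0: "cat_tri 1 n 0 = catalan n"
  by (simp add: cat_tri_1 catalan_eq_diff)

lemma cat_tri_2_0: "cat_tri 2 n 0 = catalan (Suc n)"
  using choose_odd_middle[of n] by (simp add: cat_tri_2 catalan_eq_diff)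

theorem theorem5p3:
  fixes \<alpha> \<beta> s :: complex and n :: nat
  assumes "\<alpha>\<^sup>2 - 4 * \<beta> \<noteq> 0"
    and "s\<^sup>2 = \<alpha>\<^sup>2 - 4 * \<beta>"
  shows "det (mat (n + 1) (n + 1) (\<lambda>(i, j). \<alpha>\<^sup>2 * catalan (i + j) - \<beta> * catalan (i + j + 1)))
           = 1 / (2 ^ (2 * n + 3) * s) * ((\<alpha> + s) ^ (2 * n + 3) - (\<alpha> - s) ^ (2 * n + 3))
       \<and> (\<alpha> \<noteq> 0 \<longrightarrow>
           det (mat (n + 1) (n + 1) (\<lambda>(i, j). \<alpha>\<^sup>2 * catalan (i + j + 1) - \<beta> * catalan (i + j + 2)))
           = 1 / (2 ^ (2 * n + 4) * \<alpha> * s) * ((\<alpha> + s) ^ (2 * n + 4) - (\<alpha> - s) ^ (2 * n + 4)))"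
proof -
  define x y where "x = (\<alpha> + s) / 2" and "y = (\<alpha> - s) / 2"
  have s0: "s \<noteq> 0" using assms by auto
  have xys: "x - y = s" and xya: "x + y = \<alpha>"
    by (simp_all add: x_def y_def field_simps)
  have "4 * (x * y) = \<alpha>\<^sup>2 - s\<^sup>2"
    by (simp add: x_def y_def field_simps power2_eq_square)
  then have xyb: "x * y = \<beta>"
    using assms(2) by simp
  \<comment> \<open>The diagonal entry, and the corner entry for b = 1; for b = 2 the corner agrees
    with the diagonal.\<close>
  have d: "\<alpha>\<^sup>2 - \<beta> * 2 = x\<^sup>2 + y\<^sup>2" "\<alpha>\<^sup>2 - \<beta> * 1 = x\<^sup>2 + y\<^sup>2 + x * y"
    unfolding xya[symmetric] xyb[symmetric] by (simp_all add: power2_eq_square algebra_simps)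
  have as: "x\<^sup>2 - y\<^sup>2 = \<alpha> * s"
    unfolding xya[symmetric] xys[symmetric] by (simp add: power2_eq_square algebra_simps)
  have pow: "(\<alpha> + s) ^ m - (\<alpha> - s) ^ m = 2 ^ m * (x ^ m - y ^ m)" for m
    by (simp add: x_def y_def power_divide right_diff_distrib)
  let ?H1 = "mat (n + 1) (n + 1) (\<lambda>(i, j). \<alpha>\<^sup>2 * catalan (i + j) - \<beta> * catalan (i + j + 1))"
  let ?H2 = "mat (n + 1) (n + 1) (\<lambda>(i, j). \<alpha>\<^sup>2 * catalan (i + j + 1) - \<beta> * catalan (i + j + 2))"
  have e1: "s * det ?H1 = x ^ (2 * n + 3) - y ^ (2 * n + 3)"
    using det_tridiag_odd_powers[of x y "n + 1"] det_hankel_cat_tri[of "n + 1" "\<alpha>\<^sup>2" 1 \<beta>]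
    unfolding cat_tri_1_0 d xys by (simp add: xyb eval_nat_numeral)
  have 1: "det ?H1 = 1 / (2 ^ (2 * n + 3) * s) * ((\<alpha> + s) ^ (2 * n + 3) - (\<alpha> - s) ^ (2 * n + 3))"
    unfolding pow e1[symmetric] using s0 by simp
  have e2: "\<alpha> * s * det ?H2 = x ^ (2 * n + 4) - y ^ (2 * n + 4)"
    using det_tridiag_even_powers[of x y "n + 1"] det_hankel_cat_tri[of "n + 1" "\<alpha>\<^sup>2" 2 \<beta>]
    unfolding cat_tri_2_0 d as by (simp add: xyb eval_nat_numeral)
  have "det ?H2 = 1 / (2 ^ (2 * n + 4) * \<alpha> * s) * ((\<alpha> + s) ^ (2 * n + 4) - (\<alpha> - s) ^ (2 * n + 4))"
    if "\<alpha> \<noteq> 0"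
    unfolding pow e2[symmetric] using s0 that by simp
  with 1 show ?thesis by blast
qed

end
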